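(* Let $\mathcal{P}_3=\{(x_1,x_2,x_3)\in\mathbb{R}^3 : x_1,x_2,x_3\ge 0,\ x_1+x_2+x_3=1\}$ and let $\mathcal{A}_3$ be the closure of the set of achievable vectors in $\mathcal{P}_3$, i.e. of the win vectors $\boldsymbol{wv}(\boldsymbol{T},P)$ where $\boldsymbol{T}$ ranges over all symmetric and honest $3$-player tournaments and $P$ ranges over all doubly monotonic matrices in $\mathcal{D}_3$. Then $$\mathcal{A}_{3} = \left\{ (x_1, x_2, x_3) \in \mathcal{P}_3 : x_1 \geq \tfrac{1}{3},\ x_2 \leq \tfrac{1}{2},\ x_3 \leq \tfrac{1}{3} \right\}.$$
   Context: Write $[n]=\{1,\dots,n\}$ for the set of players. Let $\mathcal{M}_n=\{P=(p_{ij})\in[0,1]^{n\times n}: P+P^T=\mathbf{1}\}$, where $\mathbf{1}$ is the all-ones matrix (so $p_{ij}+p_{ji}=1$ and $p_{ii}=\frac12$). A matrix $P\in\mathcal{M}_n$ is doubly monotonic if $p_{ij}$ is (weakly) decreasing in $i$ and (weakly) increasing in $j$; $\mathcal{D}_n$ is the set of doubly monotonic $P\in\mathcal{M}_n$. An $n$-player tournament $\boldsymbol{T}$ is a set of rules (a randomized algorithm) which, one match at a time, announces an unordered pair $\{i,j\}$ of distinct players who then play a match, receives as only information which of the two won (no draws), and eventually announces one of the $n$ players as tournament winner. The choice of the next pair, and of the winner, may depend on the results of earlier matches and on additional randomness. The number of matches is bounded by a constant depending only on $\boldsymbol{T}$. For $P\in\mathcal{M}_n$, the specialization $(\boldsymbol{T},P)$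 is the random process in which every match between $i$ and $j$ is won by $i$ with probability $p_{ij}$, independently of the past; $\pi_i(P)$ is the probability that player $i$ wins the tournament, and $\boldsymbol{wv}(\boldsymbol{T},P)=(\pi_1(P),\dots,\pi_n(P))$. Symmetric: for every $P\in\mathcal{M}_n$, every permutation $\sigma$ of $[n]$ and every $i\in[n]$, $\pi_i(P)=\pi_{\sigma(i)}(Q)$, where $Q\in\mathcal{M}_n$ is defined by $q_{\sigma(i)\sigma(j)}=p_{ij}$. Honest: for every possible state of $\boldsymbol{T}$ in which $r\ge0$ matches have been played and a pair $\{i,j\}$ has just been announced for match $r+1$ (the state includes the results of the previous matches and all random choices already made by the rules), and every $P\in\mathcal{M}_n$, one has $\pi_i^+(P)\ge\pi_i^-(P)$, where $\pi_i^+(P)$ (resp. $\pi_i^-(P)$) is the probability that $i$ wins the tournament conditioned on the current state and on $i$ winning (resp. losing) match $r+1$, with all subsequent matches decided according to $P$. *)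

theory Defs
  imports "HOL-Probability.Probability" "HOL-Combinatorics.Permutations"
begin

text \<open>
  Players are the natural numbers \<open>1, \<dots>, n\<close>. An \<open>n \<times> n\<close> matrix is a function of two natural
  numbers of which only the values at indices in \<open>{1..n}\<close> are relevant.
\<close>

definition comparison_matrices :: "nat \<Rightarrow> (nat \<Rightarrow> nat \<Rightarrow> real) set" where
  "comparison_matrices n =
     {P. \<forall>i\<in>{1..n}. \<forall>j\<in>{1..n}. P i j \<in> {0..1} \<and> P i j + P j i = 1}"

definition doubly_monotonic_matrices :: "nat \<Rightarrow> (nat \<Rightarrow> nat \<Rightarrow> real) set" where
  "doubly_monotonic_matrices n =
     {P \<in> comparison_matrices n.
        (\<forall>i\<in>{1..n}. \<forall>i'\<in>{1..n}. \<forall>j\<in>{1..n}. i \<le> i' \<longrightarrow> P i' j \<le> P i j) \<and>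
        (\<forall>i\<in>{1..n}. \<forall>j\<in>{1..n}. \<forall>j'\<in>{1..n}. j \<le> j' \<longrightarrow> P i j \<le> P i j')}"

text \<open>
  The rules of a tournament, presented as a decision tree; a state of the tournament is a node of
  the tree. \<open>Winner i\<close> announces \<open>i\<close> as tournament winner. \<open>Match i j S S'\<close> announces the pair
  \<open>{i, j}\<close> and continues with \<open>S\<close> if \<open>i\<close> wins the match and with \<open>S'\<close> if \<open>j\<close> wins it, so that
  \<open>Match i j S S'\<close> and \<open>Match j i S' S\<close> describe the same rules. \<open>Random D\<close> is a random
  choice made by the rules, with distribution \<open>D\<close> on the continuations. Since the
  continuation itself is drawn, the outcome of a random choice is part of the state, whether or
  not it shows in the next announcement.
\<close>

datatype rules =
    Winner nat
  | Match nat nat rules rules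
  | Random "rules pmf"

text \<open>
  \<open>possible_state T r S\<close>: the tournament \<open>T\<close> can get to state \<open>S\<close> after \<open>r\<close> matches.
\<close>

inductive possible_state :: "rules \<Rightarrow> nat \<Rightarrow> rules \<Rightarrow> bool" for T where
  start: "possible_state T 0 T"
| first_wins: "possible_state T r (Match i j S S') \<Longrightarrow> possible_state T (Suc r) S"
| second_wins: "possible_state T r (Match i j S S') \<Longrightarrow> possible_state T (Suc r) S'"
| random_choice: "possible_state T r (Random D) \<Longrightarrow> S \<in> set_pmf D \<Longrightarrow> possible_state T r S"

text \<open>
  Random choices may have infinite support, so the bound on the number of matches is not automatic.
\<close>

definition is_tournament :: "nat \<Rightarrow> rules \<Rightarrow> bool" where
  "is_tournament n T \<longleftrightarrow>
     (\<forall>r i. possible_state T r (Winner i) \<longrightarrow> i \<in> {1..n}) \<and>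
     (\<forall>r i j S S'. possible_state T r (Match i j S S') \<longrightarrow>
        i \<in> {1..n} \<and> j \<in> {1..n} \<and> i \<noteq> j) \<and>
     (\<exists>N. \<forall>r S. possible_state T r S \<longrightarrow> r \<le> N)"

text \<open>
  The distribution of the tournament winner when play continues from a given state and matches are
  decided according to \<open>P\<close>.
\<close>

primrec winner_pmf :: "(nat \<Rightarrow> nat \<Rightarrow> real) \<Rightarrow> rules \<Rightarrow> nat pmf" where
  "winner_pmf P (Winner i) = return_pmf i"
| "winner_pmf P (Match i j S S') =
     bind_pmf (bernoulli_pmf (P i j))
       (\<lambda>i_wins. if i_wins then winner_pmf P S else winner_pmf P S')"
| "winner_pmf P (Random D) = join_pmf (map_pmf (winner_pmf P) D)"

definition win_prob :: "rules \<Rightarrow> (nat \<Rightarrow> nat \<Rightarrow> real) \<Rightarrow> nat \<Rightarrow> real" where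
  "win_prob T P i = pmf (winner_pmf P T) i"

definition symmetric_tournament :: "nat \<Rightarrow> rules \<Rightarrow> bool" where
  "symmetric_tournament n T \<longleftrightarrow>
     (\<forall>P\<in>comparison_matrices n. \<forall>Q\<in>comparison_matrices n. \<forall>\<sigma>. \<sigma> permutes {1..n} \<longrightarrow>
        (\<forall>i\<in>{1..n}. \<forall>j\<in>{1..n}. Q (\<sigma> i) (\<sigma> j) = P i j) \<longrightarrow>
        (\<forall>i\<in>{1..n}. win_prob T P i = win_prob T Q (\<sigma> i)))"

text \<open>
  Conditioning on the current state and on the result of the announced match amounts to continuing
  from the corresponding successor state. This is also meaningful when that result has probability
  \<open>0\<close> under \<open>P\<close>. The two inequalities are the condition for the two players of the match.
\<close>

definition honest_tournament :: "nat \<Rightarrow> rules \<Rightarrow> bool" where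
  "honest_tournament n T \<longleftrightarrow>
     (\<forall>r i j S S'. possible_state T r (Match i j S S') \<longrightarrow>
        (\<forall>P\<in>comparison_matrices n.
           win_prob S P i \<ge> win_prob S' P i \<and> win_prob S' P j \<ge> win_prob S P j))"

definition win_vector3 :: "rules \<Rightarrow> (nat \<Rightarrow> nat \<Rightarrow> real) \<Rightarrow> real ^ 3" where
  "win_vector3 T P = vector [win_prob T P 1, win_prob T P 2, win_prob T P 3]"

definition prob_simplex3 :: "(real ^ 3) set" where
  "prob_simplex3 = {x. x $ 1 \<ge> 0 \<and> x $ 2 \<ge> 0 \<and> x $ 3 \<ge> 0 \<and> x $ 1 + x $ 2 + x $ 3 = 1}"

text \<open>
  The closure is taken in \<open>real ^ 3\<close>; as the simplex is closed, this is the closure in the simplex.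
\<close>

definition achievable3 :: "(real ^ 3) set" where
  "achievable3 = closure {win_vector3 T P | T P.
     is_tournament 3 T \<and> symmetric_tournament 3 T \<and> honest_tournament 3 T \<and>
     P \<in> doubly_monotonic_matrices 3}"

end

theory Submission
  imports Defs "HOL-Real_Asymp.Real_Asymp"
begin

text \<open>
  Honesty makes \<open>\<pi>\<^sub>i\<close> monotone in the entries of row \<open>i\<close>. Each of the three bounds follows by moving,
  monotonically for one player, to a matrix in which two players are interchangeable and hence win
  equally often; for instance \<open>\<pi>\<^sub>2(a, b, c) \<le> \<pi>\<^sub>2(1/2, b, b) = (1 - \<pi>\<^sub>3(1/2, b, b)) / 2 \<le> 1/2\<close>,
  where \<open>(a, b, c) = (p\<^sub>1\<^sub>2, p\<^sub>1\<^sub>3, p\<^sub>2\<^sub>3)\<close>.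

  Conversely, the region is a pentagon. For a fixed matrix the win vectors form a convex set,
  because tournaments can be mixed at random. So it suffices to approach all five vertices along one
  and the same sequence of matrices. Take \<open>(q, 1, q)\<close> with \<open>q \<longlonglongrightarrow> 1\<close> and series of \<open>N\<close> matches
  with \<open>q\<^sup>N \<longlonglongrightarrow> 0\<close>: a single match orders the players correctly, while a series is swept only when
  player 1 meets player 3. The symmetrizations of five small honest decision trees, one of them
  trivial, then tend to the vertices.
\<close>

section \<open>States and win probabilities\<close>

lemma possible_state_Winner_iff:
  "possible_state (Winner i) r U \<longleftrightarrow> r = 0 \<and> U = Winner i"
proof
  show "r = 0 \<and> U = Winner i" if "possible_state (Winner i) r U"
    using that by (induction rule: possible_state.induct) auto
qed (auto intro: possible_state.start)

text \<open>\<open>possible_state\<close> extends a path at its end, whereas recursion over a tree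
  needs the first step split off. Concatenation of paths yields the equivalences below, which do
  that.\<close>

lemma possible_state_trans:
  assumes "possible_state S r U" "possible_state T q S"
  shows "possible_state T (q + r) U"
  using assms by (induction rule: possible_state.induct) (auto intro: possible_state.intros)

lemma possible_state_Match_iff:
  "possible_state (Match i j S S') r U \<longleftrightarrow>
     r = 0 \<and> U = Match i j S S' \<or> (\<exists>q. r = Suc q \<and> (possible_state S q U \<or> possible_state S' q U))"
    (is "?L \<longleftrightarrow> ?R")
proof
  show ?R if ?L
    using that by (induction rule: possible_state.induct) (auto intro: possible_state.intros)
next
  have "possible_state (Match i j S S') (Suc 0) S" "possible_state (Match i j S S') (Suc 0) S'"
    by (auto intro: possible_state.intros)
  then show ?L if ?R
    using that by (auto intro: possible_state.start dest: possible_state_trans)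
qed

lemma possible_state_Random_iff:
  "possible_state (Random D) r U \<longleftrightarrow>
     r = 0 \<and> U = Random D \<or> (\<exists>S\<in>set_pmf D. possible_state S r U)"
    (is "?L \<longleftrightarrow> ?R")
proof
  show ?R if ?L
    using that by (induction rule: possible_state.induct) (auto intro: possible_state.intros)
next
  have "possible_state (Random D) 0 S" if "S \<in> set_pmf D" for S
    using that by (rule possible_state.random_choice[OF possible_state.start])
  then have "possible_state (Random D) r U" if "possible_state S r U" "S \<in> set_pmf D" for S
    using possible_state_trans[of S r U "Random D" 0] that by simp
  then show ?L if ?R
    using that possible_state.start by blast
qed

section \<open>Validity of rules, read off from the subtrees\<close>

lemma is_tournament_Winner_iff: "is_tournament n (Winner i) \<longleftrightarrow> i \<in> {1..n}"
  by (auto simp: is_tournament_def possible_state_Winner_iff)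

lemma is_tournament_state:
  assumes T: "is_tournament n T" and S: "possible_state T q S"
  shows "is_tournament n S"
proof -
  have trans: "possible_state T (q + r) U" if "possible_state S r U" for r U
    using that S by (rule possible_state_trans)
  obtain N where N: "r \<le> N" if "possible_state T r U" for r U
    using T unfolding is_tournament_def by blast
  have "r \<le> N" if "possible_state S r U" for r U
    using N[OF trans[OF that]] by simp
  moreover have "i \<in> {1..n}" if "possible_state S r (Winner i)" for r i
    using T trans[OF that] unfolding is_tournament_def by blast
  moreover have "i \<in> {1..n} \<and> j \<in> {1..n} \<and> i \<noteq> j" if "possible_state S r (Match i j U U')" for r i j U U'
    using T trans[OF that] unfolding is_tournament_def by blast
  ultimately show ?thesis
    unfolding is_tournament_def by blast
qed

lemma is_tournament_Match_iff:
  "is_tournament n (Match i j S S') \<longleftrightarrow>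
     i \<in> {1..n} \<and> j \<in> {1..n} \<and> i \<noteq> j \<and> is_tournament n S \<and> is_tournament n S'"
    (is "?L \<longleftrightarrow> ?R")
proof
  assume L: ?L
  have start: "possible_state (Match i j S S') 0 (Match i j S S')"
    by (rule possible_state.start)
  have "i \<in> {1..n} \<and> j \<in> {1..n} \<and> i \<noteq> j"
    using L start unfolding is_tournament_def by blast
  then show ?R
    using L is_tournament_state possible_state.first_wins[OF start] possible_state.second_wins[OF start]
    by blast
next
  assume R: ?R
  then obtain N N' where "\<forall>r U. possible_state S r U \<longrightarrow> r \<le> N"
    and "\<forall>r U. possible_state S' r U \<longrightarrow> r \<le> N'"
    unfolding is_tournament_def by blast
  then have "\<forall>r U. possible_state (Match i j S S') r U \<longrightarrow> r \<le> Suc (max N N')"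
    by (auto simp: possible_state_Match_iff le_max_iff_disj)
  moreover have "\<forall>r k. possible_state (Match i j S S') r (Winner k) \<longrightarrow> k \<in> {1..n}"
    using R unfolding is_tournament_def possible_state_Match_iff by blast
  moreover have "\<forall>r k l U U'. possible_state (Match i j S S') r (Match k l U U') \<longrightarrow>
        k \<in> {1..n} \<and> l \<in> {1..n} \<and> k \<noteq> l"
    using R unfolding is_tournament_def possible_state_Match_iff by blast
  ultimately show ?L
    unfolding is_tournament_def by blast
qed

lemma is_tournament_RandomD:
  assumes "is_tournament n (Random D)" "S \<in> set_pmf D"
  shows "is_tournament n S"
  using assms(1) possible_state.random_choice[OF possible_state.start assms(2)]
  by (rule is_tournament_state)

text \<open>Each continuation has its own bound on the number of matches; finite support gives these
  bounds a maximum.\<close>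

lemma is_tournament_Random:
  assumes "finite (set_pmf D)" "\<And>S. S \<in> set_pmf D \<Longrightarrow> is_tournament n S"
  shows "is_tournament n (Random D)"
proof -
  have "\<forall>S\<in>set_pmf D. \<exists>N. \<forall>r U. possible_state S r U \<longrightarrow> r \<le> N"
    using assms(2) unfolding is_tournament_def by blast
  then obtain N where N: "r \<le> N S" if "S \<in> set_pmf D" "possible_state S r U" for S r U
    by metis
  have "r \<le> Max (N ` set_pmf D)" if "possible_state (Random D) r U" for r U
    using that assms(1) N unfolding possible_state_Random_iff
    by (meson Max_ge finite_imageI imageI le0 order_trans)
  moreover have "\<forall>r k. possible_state (Random D) r (Winner k) \<longrightarrow> k \<in> {1..n}"
    using assms(2) unfolding is_tournament_def possible_state_Random_iff by blast
  moreover have "\<forall>r k l U U'. possible_state (Random D) r (Match k l U U') \<longrightarrow>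
        k \<in> {1..n} \<and> l \<in> {1..n} \<and> k \<noteq> l"
    using assms(2) unfolding is_tournament_def possible_state_Random_iff by blast
  ultimately show ?thesis
    unfolding is_tournament_def by blast
qed

section \<open>Honesty, read off from the subtrees\<close>

lemma honest_tournament_Winner: "honest_tournament n (Winner i)"
  by (auto simp: honest_tournament_def possible_state_Winner_iff)

lemma honest_tournament_state:
  assumes T: "honest_tournament n T" and S: "possible_state T q S"
  shows "honest_tournament n S"
proof -
  have trans: "possible_state T (q + r) U" if "possible_state S r U" for r U
    using that S by (rule possible_state_trans)
  show ?thesis
    unfolding honest_tournament_def
  proof (intro allI impI)
    fix r i j U U'
    assume "possible_state S r (Match i j U U')"
    then show "\<forall>P\<in>comparison_matrices n. win_prob U' P i \<le> win_prob U P i \<and> win_prob U P j \<le> win_prob U' P j"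
      using T trans unfolding honest_tournament_def by blast
  qed
qed

lemma honest_tournament_Match_iff:
  "honest_tournament n (Match i j S S') \<longleftrightarrow>
     (\<forall>P\<in>comparison_matrices n. win_prob S' P i \<le> win_prob S P i \<and> win_prob S P j \<le> win_prob S' P j) \<and>
     honest_tournament n S \<and> honest_tournament n S'"
    (is "?L \<longleftrightarrow> ?R")
proof
  assume L: ?L
  have start: "possible_state (Match i j S S') 0 (Match i j S S')"
    by (rule possible_state.start)
  have "\<forall>P\<in>comparison_matrices n. win_prob S' P i \<le> win_prob S P i \<and> win_prob S P j \<le> win_prob S' P j"
    using L start unfolding honest_tournament_def by blast
  then show ?R
    using honest_tournament_state[OF L possible_state.first_wins[OF start]]
      honest_tournament_state[OF L possible_state.second_wins[OF start]]
    by blast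
next
  assume R: ?R
  show ?L
    unfolding honest_tournament_def
  proof (intro allI impI)
    fix r k l U U'
    assume "possible_state (Match i j S S') r (Match k l U U')"
    then consider "k = i" "l = j" "U = S" "U' = S'"
      | q where "possible_state S q (Match k l U U')"
      | q where "possible_state S' q (Match k l U U')"
      by (auto simp: possible_state_Match_iff)
    then show "\<forall>P\<in>comparison_matrices n. win_prob U' P k \<le> win_prob U P k \<and> win_prob U P l \<le> win_prob U' P l"
    proof cases
      case 1
      then show ?thesis using R by blast
    next
      case 2
      then show ?thesis using R unfolding honest_tournament_def by blast
    next
      case 3
      then show ?thesis using R unfolding honest_tournament_def by blast
    qed
  qed
qed

lemma honest_tournament_Random_iff:
  "honest_tournament n (Random D) \<longleftrightarrow> (\<forall>S\<in>set_pmf D. honest_tournament n S)"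
    (is "?L \<longleftrightarrow> ?R")
proof
  show ?R if ?L
    using that honest_tournament_state possible_state.random_choice[OF possible_state.start] by blast
next
  assume R: ?R
  show ?L
    unfolding honest_tournament_def
  proof (intro allI impI)
    fix r k l U U'
    assume "possible_state (Random D) r (Match k l U U')"
    then obtain S where "S \<in> set_pmf D" "possible_state S r (Match k l U U')"
      by (auto simp: possible_state_Random_iff)
    then show "\<forall>P\<in>comparison_matrices n. win_prob U' P k \<le> win_prob U P k \<and> win_prob U P l \<le> win_prob U' P l"
      using R unfolding honest_tournament_def by blast
  qed
qed

section \<open>Win probabilities and their monotonicity\<close>

lemma win_prob_Winner: "win_prob (Winner j) P i = of_bool (i = j)"
  by (simp add: win_prob_def pmf_return indicator_def)

lemma win_prob_Match:
  assumes "P i j \<in> {0..1}"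
  shows "win_prob (Match i j S S') P k = P i j * win_prob S P k + (1 - P i j) * win_prob S' P k"
  using assms by (simp add: win_prob_def pmf_bind)

lemma win_prob_Random: "win_prob (Random D) P k = measure_pmf.expectation D (\<lambda>S. win_prob S P k)"
  by (simp add: win_prob_def pmf_join)

lemma win_prob_nonneg: "0 \<le> win_prob T P i"
  and win_prob_le_1: "win_prob T P i \<le> 1"
  by (auto simp: win_prob_def pmf_nonneg pmf_le_1)

lemma integrable_win_prob: "integrable (measure_pmf D) (\<lambda>S. win_prob S P k)"
  by (rule measure_pmf.integrable_const_bound[where B = 1])
     (auto simp: win_prob_nonneg win_prob_le_1)

lemma set_winner_pmf:
  assumes "is_tournament n T"
  shows "set_pmf (winner_pmf P T) \<subseteq> {1..n}"
  using assms
proof (induction T)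
  case (Match i j S S')
  then have "set_pmf (winner_pmf P S) \<subseteq> {1..n}" "set_pmf (winner_pmf P S') \<subseteq> {1..n}"
    by (auto simp: is_tournament_Match_iff)
  then show ?case
    unfolding winner_pmf.simps set_bind_pmf by (intro UN_least) (metis (full_types))
next
  case (Random D)
  then show ?case by (auto dest!: is_tournament_RandomD)
qed (simp add: is_tournament_Winner_iff)

lemma sum_win_prob:
  assumes "is_tournament n T"
  shows "(\<Sum>i\<in>{1..n}. win_prob T P i) = 1"
  unfolding win_prob_def using set_winner_pmf[OF assms] by (intro sum_pmf_eq_1) auto

lemma comparison_matrix_range:
  assumes "P \<in> comparison_matrices n" "i \<in> {1..n}" "j \<in> {1..n}"
  shows "P i j \<in> {0..1}" "P j i = 1 - P i j"
  using assms unfolding comparison_matrices_def by (auto simp: algebra_simps)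

text \<open>Matrices are total functions with arbitrary values off \<open>{1..n}\<close>; valid
  rules only ever pair actual players, so those values never enter.\<close>

lemma winner_pmf_cong:
  assumes "is_tournament n T" "\<And>i j. i \<in> {1..n} \<Longrightarrow> j \<in> {1..n} \<Longrightarrow> P i j = Q i j"
  shows "winner_pmf P T = winner_pmf Q T"
  using assms(1)
proof (induction T)
  case (Match i j S S')
  then have "winner_pmf P S = winner_pmf Q S" "winner_pmf P S' = winner_pmf Q S'" "P i j = Q i j"
    by (auto simp: is_tournament_Match_iff assms(2))
  then show ?case by (simp cong: if_cong)
next
  case (Random D)
  then have "map_pmf (winner_pmf P) D = map_pmf (winner_pmf Q) D"
    by (intro pmf.map_cong) (auto dest: is_tournament_RandomD)
  then show ?case by simp
qed simp

text \<open>At each match the passage from \<open>P\<close> to \<open>Q\<close> has two stages: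
  first inside both successor states, by induction, then at the match itself, where honesty under
  \<open>Q\<close> makes a better chance for \<open>i\<close> in that match favourable to
  \<open>i\<close>.\<close>

lemma win_prob_mono:
  assumes "is_tournament n T" "honest_tournament n T"
    and P: "P \<in> comparison_matrices n" and Q: "Q \<in> comparison_matrices n" and i: "i \<in> {1..n}"
    and row: "\<And>j. j \<in> {1..n} \<Longrightarrow> P i j \<le> Q i j"
    and rest: "\<And>k l. k \<in> {1..n} \<Longrightarrow> l \<in> {1..n} \<Longrightarrow> k \<noteq> i \<Longrightarrow> l \<noteq> i \<Longrightarrow> P k l = Q k l"
  shows "win_prob T P i \<le> win_prob T Q i"
  using assms(1,2)
proof (induction T)
  case (Winner j)
  then show ?case by (simp add: win_prob_Winner)
next
  case (Match k l S S')
  then have kl: "k \<in> {1..n}" "l \<in> {1..n}" "k \<noteq> l"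
    and S: "win_prob S P i \<le> win_prob S Q i" and S': "win_prob S' P i \<le> win_prob S' Q i"
    and honest: "win_prob S' Q k \<le> win_prob S Q k" "win_prob S Q l \<le> win_prob S' Q l"
    using Q by (auto simp: is_tournament_Match_iff honest_tournament_Match_iff)
  note Pkl = comparison_matrix_range[OF P kl(1,2)] and Qkl = comparison_matrix_range[OF Q kl(1,2)]
  have "win_prob (Match k l S S') P i = P k l * win_prob S P i + (1 - P k l) * win_prob S' P i"
    by (rule win_prob_Match) (fact Pkl)
  also have "\<dots> \<le> P k l * win_prob S Q i + (1 - P k l) * win_prob S' Q i"
    using S S' Pkl by (intro add_mono mult_left_mono) auto
  also have "\<dots> \<le> Q k l * win_prob S Q i + (1 - Q k l) * win_prob S' Q i"
  proof -
    \<comment> \<open>Both factors are nonnegative if \<open>i\<close> is named first and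
      nonpositive if \<open>i\<close> is named second; the first factor vanishes if \<open>i\<close>
      does not play.\<close>
    have "0 \<le> (Q k l - P k l) * (win_prob S Q i - win_prob S' Q i)"
    proof -
      consider "k = i" | "l = i" | "k \<noteq> i" "l \<noteq> i" by blast
      then show ?thesis
      proof cases
        case 1
        then show ?thesis using row[OF kl(2)] honest by simp
      next
        case 2
        then have "Q k l \<le> P k l" using row[OF kl(1)] Pkl Qkl by simp
        then show ?thesis using 2 honest by (simp add: mult_nonpos_nonpos)
      next
        case 3
        then show ?thesis using rest[OF kl(1,2)] by simp
      qed
    qed
    then show ?thesis by (simp add: algebra_simps)
  qed
  also have "\<dots> = win_prob (Match k l S S') Q i"
    by (rule win_prob_Match[symmetric]) (fact Qkl)
  finally show ?case .
next
  case (Random D)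
  then have "win_prob S P i \<le> win_prob S Q i" if "S \<in> set_pmf D" for S
    using that by (auto dest: is_tournament_RandomD simp: honest_tournament_Random_iff)
  then show ?case
    unfolding win_prob_Random
    by (intro integral_mono_AE integrable_win_prob) (auto simp: AE_measure_pmf_iff)
qed

section \<open>Bounds for honest and symmetric tournaments\<close>

text \<open>The parameters are the entries above the diagonal, \<open>p\<^sub>1\<^sub>2\<close>,
  \<open>p\<^sub>1\<^sub>3\<close>, \<open>p\<^sub>2\<^sub>3\<close>; complementarity fixes the
  others.\<close>

definition matrix3 :: "real \<Rightarrow> real \<Rightarrow> real \<Rightarrow> nat \<Rightarrow> nat \<Rightarrow> real" where
  "matrix3 a b c i j =
     (if i = j then 1/2
      else if i = 1 then (if j = 2 then a else b)
      else if i = 2 then (if j = 1 then 1 - a else c)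
      else (if j = 1 then 1 - b else 1 - c))"

lemma matrix3_simps [simp]:
  "matrix3 a b c i i = 1/2"
  "matrix3 a b c (Suc 0) 2 = a" "matrix3 a b c 2 (Suc 0) = 1 - a"
  "matrix3 a b c (Suc 0) 3 = b" "matrix3 a b c 3 (Suc 0) = 1 - b"
  "matrix3 a b c 2 3 = c" "matrix3 a b c 3 2 = 1 - c"
  by (simp_all add: matrix3_def)

lemma atLeastAtMost_1_3: "{1..3} = {1, 2, 3::nat}" "{Suc 0..3} = {1, 2, 3}"
  by auto

lemma matrix3_comparison:
  assumes "a \<in> {0..1}" "b \<in> {0..1}" "c \<in> {0..1}"
  shows "matrix3 a b c \<in> comparison_matrices 3"
  using assms unfolding comparison_matrices_def atLeastAtMost_1_3 by auto

lemma matrix3_doubly_monotonic: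
  assumes "1/2 \<le> a" "a \<le> b" "1/2 \<le> c" "c \<le> b" "b \<le> 1"
  shows "matrix3 a b c \<in> doubly_monotonic_matrices 3"
proof -
  have "matrix3 a b c \<in> comparison_matrices 3"
    using assms by (intro matrix3_comparison) auto
  then show ?thesis
    using assms unfolding doubly_monotonic_matrices_def atLeastAtMost_1_3 by auto
qed

lemma doubly_monotonic3E:
  assumes "P \<in> doubly_monotonic_matrices 3"
  obtains a b c where "1/2 \<le> a" "a \<le> b" "1/2 \<le> c" "c \<le> b" "b \<le> 1"
    "\<And>i j. i \<in> {1..3} \<Longrightarrow> j \<in> {1..3} \<Longrightarrow> P i j = matrix3 a b c i j"
proof -
  have cmp: "\<forall>i\<in>{1..3}. \<forall>j\<in>{1..3}. P i j \<in> {0..1} \<and> P i j + P j i = 1"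
    and mono: "\<forall>i\<in>{1..3}. \<forall>j\<in>{1..3}. \<forall>j'\<in>{1..3}. j \<le> j' \<longrightarrow> P i j \<le> P i j'"
    using assms unfolding doubly_monotonic_matrices_def comparison_matrices_def by auto
  have "P 1 1 + P 1 1 = 1" "P 2 2 + P 2 2 = 1" "P 3 3 + P 3 3 = 1"
    "P 1 2 + P 2 1 = 1" "P 1 3 + P 3 1 = 1" "P 2 3 + P 3 2 = 1" "P 1 3 \<le> 1"
    using cmp by (auto simp: atLeastAtMost_1_3)
  \<comment> \<open>The diagonal value 1/2 provides the lower bounds on \<open>a\<close> and
    \<open>c\<close>; the last inequality is \<open>c \<le> b\<close>, written for the complementary
    entries.\<close>
  moreover have "P 1 1 \<le> P 1 2" "P 1 2 \<le> P 1 3" "P 2 2 \<le> P 2 3" "P 3 1 \<le> P 3 2"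
    using mono by (auto simp: atLeastAtMost_1_3)
  ultimately show ?thesis
    by (intro that[of "P 1 2" "P 1 3" "P 2 3"]) (auto simp: atLeastAtMost_1_3)
qed

text \<open>Applied below with \<open>P = Q\<close> invariant under swapping \<open>k\<close> and
  \<open>l\<close>, where it says that these two players win equally often.\<close>

lemma symmetric_tournament_transpose:
  assumes sym: "symmetric_tournament 3 T"
    and "P \<in> comparison_matrices 3" "Q \<in> comparison_matrices 3" "k \<in> {1..3}" "l \<in> {1..3}"
    and "\<And>i j. i \<in> {1..3} \<Longrightarrow> j \<in> {1..3} \<Longrightarrow> Q (Transposition.transpose k l i) (Transposition.transpose k l j) = P i j"
  shows "win_prob T P k = win_prob T Q l"
proof -
  have "Transposition.transpose k l permutes {1..3}"
    using assms(4,5) by (rule permutes_swap_id)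
  then have "win_prob T P k = win_prob T Q (Transposition.transpose k l k)"
    using assms unfolding symmetric_tournament_def by blast
  then show ?thesis by simp
qed

context
  fixes T
  assumes T: "is_tournament 3 T" "honest_tournament 3 T" "symmetric_tournament 3 T"
begin

lemma win_prob3_sum: "win_prob T P 1 + win_prob T P 2 + win_prob T P 3 = 1"
  using sum_win_prob[OF T(1), of P] by (simp add: atLeastAtMost_1_3)

text \<open>Off the diagonal the rows are \<open>(a, b)\<close>, \<open>(1 - a, c)\<close> and
  \<open>(1 - b, 1 - c)\<close>, which fixes the direction of each inequality.\<close>

lemma win_prob3_mono:
  assumes "{a, b, c, a', b', c'} \<subseteq> {0..1}"
  shows "\<lbrakk>a \<le> a'; b \<le> b'; c = c'\<rbrakk> \<Longrightarrow>
      win_prob T (matrix3 a b c) 1 \<le> win_prob T (matrix3 a' b' c') 1"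
    and "\<lbrakk>a' \<le> a; b = b'; c \<le> c'\<rbrakk> \<Longrightarrow>
      win_prob T (matrix3 a b c) 2 \<le> win_prob T (matrix3 a' b' c') 2"
    and "\<lbrakk>a = a'; b' \<le> b; c' \<le> c\<rbrakk> \<Longrightarrow>
      win_prob T (matrix3 a b c) 3 \<le> win_prob T (matrix3 a' b' c') 3"
  by (rule win_prob_mono[OF T(1,2)];
      use assms in \<open>auto simp: atLeastAtMost_1_3 intro!: matrix3_comparison\<close>)+

lemma win_prob3_tie12:
  assumes "c \<in> {0..1}"
  shows "win_prob T (matrix3 (1/2) c c) 1 = win_prob T (matrix3 (1/2) c c) 2"
  by (rule symmetric_tournament_transpose[OF T(3)];
      use assms in \<open>auto simp: atLeastAtMost_1_3 Transposition.transpose_def intro!: matrix3_comparison\<close>)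

lemma win_prob3_tie23:
  assumes "a \<in> {0..1}"
  shows "win_prob T (matrix3 a a (1/2)) 2 = win_prob T (matrix3 a a (1/2)) 3"
  by (rule symmetric_tournament_transpose[OF T(3)];
      use assms in \<open>auto simp: atLeastAtMost_1_3 Transposition.transpose_def intro!: matrix3_comparison\<close>)

text \<open>At \<open>(1/2, 1/2, 1/2)\<close> all players win with probability 1/3. From there
  \<open>\<pi>\<^sub>1(a, b, c) \<ge> \<pi>\<^sub>1(1/2, c, c) = (1 - \<pi>\<^sub>3(1/2, c, c)) / 2
  \<ge> 1/3\<close>, and dually \<open>\<pi>\<^sub>3(a, b, c) \<le> \<pi>\<^sub>3(a, a, 1/2) = (1 -
  \<pi>\<^sub>1(a, a, 1/2)) / 2 \<le> 1/3\<close>.\<close>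

lemma win_prob3_bounds:
  assumes "1/2 \<le> a" "a \<le> b" "1/2 \<le> c" "c \<le> b" "b \<le> 1"
  shows "1/3 \<le> win_prob T (matrix3 a b c) 1" "win_prob T (matrix3 a b c) 2 \<le> 1/2"
    "win_prob T (matrix3 a b c) 3 \<le> 1/3"
proof -
  let ?w = "\<lambda>a b c. win_prob T (matrix3 a b c)"
  have level: "?w (1/2) (1/2) (1/2) 1 = 1/3" "?w (1/2) (1/2) (1/2) 3 = 1/3"
    using win_prob3_tie12[of "1/2"] win_prob3_tie23[of "1/2"] win_prob3_sum[of "matrix3 (1/2) (1/2) (1/2)"]
    by auto
  have "?w (1/2) c c 3 \<le> 1/3"
    using win_prob3_mono(3)[of "1/2" c c "1/2" "1/2" "1/2"] level assms by simp
  moreover have "?w (1/2) c c 1 \<le> ?w a b c 1"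
    using assms by (intro win_prob3_mono) auto
  ultimately show "1/3 \<le> ?w a b c 1"
    using win_prob3_tie12[of c] win_prob3_sum[of "matrix3 (1/2) c c"] assms by simp
  have "1/3 \<le> ?w a a (1/2) 1"
    using win_prob3_mono(1)[of "1/2" "1/2" "1/2" a a "1/2"] level assms by simp
  moreover have "?w a b c 3 \<le> ?w a a (1/2) 3"
    using assms by (intro win_prob3_mono) auto
  ultimately show "?w a b c 3 \<le> 1/3"
    using win_prob3_tie23[of a] win_prob3_sum[of "matrix3 a a (1/2)"] assms by simp
  have "?w a b c 2 \<le> ?w (1/2) b b 2"
    using assms by (intro win_prob3_mono) auto
  then show "?w a b c 2 \<le> 1/2"
    using win_prob3_tie12[of b] win_prob3_sum[of "matrix3 (1/2) b b"] win_prob_nonneg[of T "matrix3 (1/2) b b" 3] assms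
    by simp
qed

end

section \<open>Symmetrization\<close>

primrec relabel :: "(nat \<Rightarrow> nat) \<Rightarrow> rules \<Rightarrow> rules" where
  "relabel \<sigma> (Winner i) = Winner (\<sigma> i)"
| "relabel \<sigma> (Match i j S S') = Match (\<sigma> i) (\<sigma> j) (relabel \<sigma> S) (relabel \<sigma> S')"
| "relabel \<sigma> (Random D) = Random (map_pmf (relabel \<sigma>) D)"

lemma relabel_relabel: "relabel \<tau> (relabel \<sigma> T) = relabel (\<tau> \<circ> \<sigma>) T"
proof (induction T)
  case (Random D)
  then have "map_pmf (relabel \<tau> \<circ> relabel \<sigma>) D = map_pmf (relabel (\<tau> \<circ> \<sigma>)) D"
    by (intro pmf.map_cong) (simp_all add: comp_def)
  then show ?case by (simp add: pmf.map_comp comp_def)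
qed auto

lemma relabel_eq_iff:
  "relabel \<sigma> V = Winner i \<longleftrightarrow> (\<exists>i'. V = Winner i' \<and> i = \<sigma> i')"
  "relabel \<sigma> V = Match i j S S' \<longleftrightarrow>
     (\<exists>i' j' U U'. V = Match i' j' U U' \<and> i = \<sigma> i' \<and> j = \<sigma> j' \<and> S = relabel \<sigma> U \<and> S' = relabel \<sigma> U')"
  "relabel \<sigma> V = Random D \<longleftrightarrow> (\<exists>D'. V = Random D' \<and> D = map_pmf (relabel \<sigma>) D')"
  by (cases V; auto)+

text \<open>Validity and honesty quantify over states; this pulls every state of the relabelled tree
  back to the original one, so both properties transfer.\<close>

lemma possible_state_relabelE:
  assumes "possible_state (relabel \<sigma> T) r U"
  obtains V where "U = relabel \<sigma> V" "possible_state T r V"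
proof -
  from assms have "\<exists>V. U = relabel \<sigma> V \<and> possible_state T r V"
  proof (induction rule: possible_state.induct)
    case start
    show ?case by (blast intro: possible_state.start)
  next
    case (first_wins r i j S S')
    then obtain V where "relabel \<sigma> V = Match i j S S'" "possible_state T r V" by metis
    then show ?case by (auto simp: relabel_eq_iff intro: possible_state.first_wins)
  next
    case (second_wins r i j S S')
    then obtain V where "relabel \<sigma> V = Match i j S S'" "possible_state T r V" by metis
    then show ?case by (auto simp: relabel_eq_iff intro: possible_state.second_wins)
  next
    case (random_choice r D S)
    then obtain V where "relabel \<sigma> V = Random D" "possible_state T r V" by metis
    then obtain D' where "possible_state T r (Random D')" "D = map_pmf (relabel \<sigma>) D'"
      by (auto simp: relabel_eq_iff)
    with random_choice.hyps show ?case
      by (auto dest: possible_state.random_choice)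
  qed
  then show ?thesis using that by blast
qed

lemma winner_pmf_relabel:
  assumes "\<And>i j. Q (\<sigma> i) (\<sigma> j) = P i j"
  shows "winner_pmf Q (relabel \<sigma> T) = map_pmf \<sigma> (winner_pmf P T)"
proof (induction T)
  case (Match i j S S')
  then show ?case
    by (auto simp: assms map_bind_pmf intro: bind_pmf_cong)
next
  case (Random D)
  then have "map_pmf (winner_pmf Q \<circ> relabel \<sigma>) D = map_pmf (map_pmf \<sigma> \<circ> winner_pmf P) D"
    by (intro pmf.map_cong) auto
  then show ?case by (simp add: pmf.map_comp map_join_pmf)
qed simp

lemma win_prob_relabel:
  assumes "inj \<sigma>" "\<And>i j. Q (\<sigma> i) (\<sigma> j) = P i j"
  shows "win_prob (relabel \<sigma> T) Q (\<sigma> i) = win_prob T P i"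
  using assms by (simp add: win_prob_def winner_pmf_relabel pmf_map_inj')

lemma is_tournament_relabel:
  assumes T: "is_tournament n T" and \<sigma>: "\<sigma> permutes {1..n}"
  shows "is_tournament n (relabel \<sigma> T)"
proof -
  obtain N where N: "r \<le> N" if "possible_state T r U" for r U
    using T unfolding is_tournament_def by blast
  have "r \<le> N" if "possible_state (relabel \<sigma> T) r U" for r U
    using that N by (blast elim: possible_state_relabelE)
  moreover have "i \<in> {1..n}" if state: "possible_state (relabel \<sigma> T) r (Winner i)" for r i
  proof -
    obtain V where "Winner i = relabel \<sigma> V" "possible_state T r V"
      using state by (rule possible_state_relabelE)
    then obtain i' where "possible_state T r (Winner i')" "i = \<sigma> i'"
      by (metis relabel_eq_iff(1))
    then show ?thesis
      using T permutes_in_image[OF \<sigma>] unfolding is_tournament_def by blast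
  qed
  moreover have "i \<in> {1..n} \<and> j \<in> {1..n} \<and> i \<noteq> j"
    if state: "possible_state (relabel \<sigma> T) r (Match i j S S')" for r i j S S'
  proof -
    obtain V where "Match i j S S' = relabel \<sigma> V" "possible_state T r V"
      using state by (rule possible_state_relabelE)
    then obtain i' j' U U' where "possible_state T r (Match i' j' U U')" "i = \<sigma> i'" "j = \<sigma> j'"
      by (metis relabel_eq_iff(2))
    moreover from this have "i' \<in> {1..n} \<and> j' \<in> {1..n} \<and> i' \<noteq> j'"
      using T unfolding is_tournament_def by blast
    ultimately show ?thesis
      using permutes_in_image[OF \<sigma>] permutes_inj[OF \<sigma>] by (auto dest: injD)
  qed
  ultimately show ?thesis
    unfolding is_tournament_def by blast
qed

lemma comparison_matrices_permute:
  assumes "P \<in> comparison_matrices n" "\<sigma> permutes {1..n}"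
  shows "(\<lambda>i j. P (\<sigma> i) (\<sigma> j)) \<in> comparison_matrices n"
  using assms(1) permutes_in_image[OF assms(2)] unfolding comparison_matrices_def by blast

text \<open>The relabelled tree facing \<open>P\<close> behaves like the original tree facing
  \<open>P\<close> with its indices permuted, which is again a comparison matrix.\<close>

lemma honest_tournament_relabel:
  assumes T: "honest_tournament n T" and \<sigma>: "\<sigma> permutes {1..n}"
  shows "honest_tournament n (relabel \<sigma> T)"
  unfolding honest_tournament_def
proof (intro allI impI ballI)
  fix r i j S S' P
  assume state: "possible_state (relabel \<sigma> T) r (Match i j S S')" and P: "P \<in> comparison_matrices n"
  obtain V where "Match i j S S' = relabel \<sigma> V" "possible_state T r V"
    using state by (rule possible_state_relabelE)
  then obtain i' j' U U' where U: "possible_state T r (Match i' j' U U')"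
    and eq: "i = \<sigma> i'" "j = \<sigma> j'" "S = relabel \<sigma> U" "S' = relabel \<sigma> U'"
    by (metis relabel_eq_iff(2))
  let ?Q = "\<lambda>i j. P (\<sigma> i) (\<sigma> j)"
  have "win_prob U' ?Q i' \<le> win_prob U ?Q i' \<and> win_prob U ?Q j' \<le> win_prob U' ?Q j'"
    using T U comparison_matrices_permute[OF P \<sigma>] unfolding honest_tournament_def by blast
  moreover have "win_prob (relabel \<sigma> W) P (\<sigma> k) = win_prob W ?Q k" for W k
    using permutes_inj[OF \<sigma>] by (rule win_prob_relabel) simp
  ultimately show "win_prob S' P i \<le> win_prob S P i \<and> win_prob S P j \<le> win_prob S' P j"
    by (simp add: eq)
qed

text \<open>The players are assigned to the roles uniformly at random. The draw is part of the
  state, so honesty has to hold for each relabelled copy separately.\<close>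

definition symmetrize :: "nat \<Rightarrow> rules \<Rightarrow> rules" where
  "symmetrize n T = Random (map_pmf (\<lambda>\<sigma>. relabel \<sigma> T) (pmf_of_set {\<sigma>. \<sigma> permutes {1..n}}))"

lemma permutations_finite_nonempty:
  "finite {\<sigma>. \<sigma> permutes {1..n::nat}}" "{\<sigma>. \<sigma> permutes {1..n::nat}} \<noteq> {}"
  using permutes_id[of "{1..n}"] by (blast intro: finite_permutations)+

lemma win_prob_symmetrize:
  "win_prob (symmetrize n T) P i = (\<Sum>\<sigma> | \<sigma> permutes {1..n}. win_prob (relabel \<sigma> T) P i) / fact n"
  using permutations_finite_nonempty[of n]
  by (simp add: symmetrize_def win_prob_Random integral_pmf_of_set card_permutations)

lemma is_tournament_symmetrize: "is_tournament n T \<Longrightarrow> is_tournament n (symmetrize n T)"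
  using permutations_finite_nonempty[of n] unfolding symmetrize_def
  by (intro is_tournament_Random) (auto simp: is_tournament_relabel)

lemma honest_tournament_symmetrize: "honest_tournament n T \<Longrightarrow> honest_tournament n (symmetrize n T)"
  using permutations_finite_nonempty[of n] unfolding symmetrize_def
  by (auto simp: honest_tournament_Random_iff honest_tournament_relabel)

text \<open>Renaming the players by \<open>\<tau>\<close> turns the summand of
  \<open>\<sigma>\<close> into that of \<open>\<tau> \<circ> \<sigma>\<close>, and this only
  reorders the sum over all permutations.\<close>

lemma symmetric_tournament_symmetrize:
  assumes T: "is_tournament n T"
  shows "symmetric_tournament n (symmetrize n T)"
  unfolding symmetric_tournament_def
proof (intro ballI allI impI)
  fix P Q :: "nat \<Rightarrow> nat \<Rightarrow> real" and \<tau> i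
  assume \<tau>: "\<tau> permutes {1..n}" and Q: "\<forall>i\<in>{1..n}. \<forall>j\<in>{1..n}. Q (\<tau> i) (\<tau> j) = P i j"
  have "win_prob (relabel \<sigma> T) P i = win_prob (relabel (\<tau> \<circ> \<sigma>) T) Q (\<tau> i)"
    if \<sigma>: "\<sigma> permutes {1..n}" for \<sigma>
  proof -
    \<comment> \<open>\<open>win_prob_relabel\<close> wants agreement at all indices, but
      \<open>P\<close> and the permuted \<open>Q\<close> agree only at players; so \<open>P\<close>
      is replaced by the permuted \<open>Q\<close> first.\<close>
    have "winner_pmf P (relabel \<sigma> T) = winner_pmf (\<lambda>i j. Q (\<tau> i) (\<tau> j)) (relabel \<sigma> T)"
      using is_tournament_relabel[OF T \<sigma>] by (rule winner_pmf_cong) (use Q in auto)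
    moreover have "win_prob (relabel \<tau> (relabel \<sigma> T)) Q (\<tau> i) = win_prob (relabel \<sigma> T) (\<lambda>i j. Q (\<tau> i) (\<tau> j)) i"
      using permutes_inj[OF \<tau>] by (rule win_prob_relabel) simp
    ultimately show ?thesis
      by (simp add: relabel_relabel win_prob_def)
  qed
  then have "(\<Sum>\<sigma> | \<sigma> permutes {1..n}. win_prob (relabel \<sigma> T) P i) =
      (\<Sum>\<sigma> | \<sigma> permutes {1..n}. win_prob (relabel (\<tau> \<circ> \<sigma>) T) Q (\<tau> i))"
    by (intro sum.cong) auto
  also have "\<dots> = (\<Sum>\<sigma> | \<sigma> permutes {1..n}. win_prob (relabel \<sigma> T) Q (\<tau> i))"
    using setum_permutations_compose_left[OF \<tau>, of "\<lambda>\<sigma>. win_prob (relabel \<sigma> T) Q (\<tau> i)"] by simp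
  finally show "win_prob (symmetrize n T) P i = win_prob (symmetrize n T) Q (\<tau> i)"
    by (simp add: win_prob_symmetrize)
qed

lemma sum_permutations_3:
  fixes f :: "nat \<Rightarrow> nat \<Rightarrow> nat \<Rightarrow> real"
  shows "(\<Sum>\<sigma> | \<sigma> permutes {1..3}. f (\<sigma> 1) (\<sigma> 2) (\<sigma> 3)) =
    f 1 2 3 + f 1 3 2 + f 2 1 3 + f 2 3 1 + f 3 1 2 + f 3 2 1"
  unfolding atLeastAtMost_1_3
  by (simp add: sum_over_permutations_insert Transposition.transpose_def)

section \<open>Mixtures\<close>

definition fair_tournaments :: "nat \<Rightarrow> rules set" where
  "fair_tournaments n = {T. is_tournament n T \<and> symmetric_tournament n T \<and> honest_tournament n T}"

definition mix :: "real \<Rightarrow> rules \<Rightarrow> rules \<Rightarrow> rules" where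
  "mix t S T = Random (map_pmf (\<lambda>b. if b then S else T) (bernoulli_pmf t))"

lemma win_prob_mix:
  assumes "t \<in> {0..1}"
  shows "win_prob (mix t S T) P i = t * win_prob S P i + (1 - t) * win_prob T P i"
  using assms by (simp add: mix_def win_prob_Random)

text \<open>Validity and honesty are checked branch by branch; symmetry survives because win
  probabilities are affine in the mixture.\<close>

lemma mix_fair:
  assumes t: "t \<in> {0..1}" and ST: "S \<in> fair_tournaments n" "T \<in> fair_tournaments n"
  shows "mix t S T \<in> fair_tournaments n"
proof -
  have "is_tournament n (mix t S T)"
    using ST unfolding mix_def fair_tournaments_def by (intro is_tournament_Random) auto
  moreover have "honest_tournament n (mix t S T)"
    using ST unfolding mix_def fair_tournaments_def by (auto simp: honest_tournament_Random_iff)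
  moreover have "symmetric_tournament n (mix t S T)"
    using ST unfolding fair_tournaments_def symmetric_tournament_def
    by (simp add: win_prob_mix[OF t])
  ultimately show ?thesis by (simp add: fair_tournaments_def)
qed

lemma symmetrize_fair:
  assumes "is_tournament n T" "honest_tournament n T"
  shows "symmetrize n T \<in> fair_tournaments n"
  using assms by (simp add: fair_tournaments_def is_tournament_symmetrize
      honest_tournament_symmetrize symmetric_tournament_symmetrize)

lemma win_vector3_component [simp]:
  "win_vector3 T P $ 1 = win_prob T P 1"
  "win_vector3 T P $ 2 = win_prob T P 2"
  "win_vector3 T P $ 3 = win_prob T P 3"
  by (simp_all add: win_vector3_def vector_3)

lemma convex_win_vector3: "convex ((\<lambda>T. win_vector3 T P) ` fair_tournaments 3)"
proof (rule convexI, elim imageE, hypsubst)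
  fix S T :: rules and u v :: real
  assume uv: "0 \<le> u" "0 \<le> v" "u + v = 1" and ST: "S \<in> fair_tournaments 3" "T \<in> fair_tournaments 3"
  then have u: "u \<in> {0..1}" "v = 1 - u" by auto
  have "u *\<^sub>R win_vector3 S P + v *\<^sub>R win_vector3 T P = win_vector3 (mix u S T) P"
    by (simp add: vec_eq_iff forall_3 win_prob_mix[OF u(1)] u(2))
  then show "u *\<^sub>R win_vector3 S P + v *\<^sub>R win_vector3 T P \<in> (\<lambda>T. win_vector3 T P) ` fair_tournaments 3"
    using mix_fair[OF u(1) ST] by simp
qed

lemma convex_limits:
  fixes K :: "nat \<Rightarrow> 'a::real_normed_vector set"
  assumes "\<And>n. convex (K n)"
  shows "convex {x. \<exists>f. (\<forall>n. f n \<in> K n) \<and> f \<longlonglongrightarrow> x}"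
proof (rule convexI, clarsimp)
  fix f g x y and u v :: real
  assume *: "0 \<le> u" "0 \<le> v" "u + v = 1" "\<forall>n. f n \<in> K n" "f \<longlonglongrightarrow> x" "\<forall>n. g n \<in> K n" "g \<longlonglongrightarrow> y"
  then have "(\<lambda>n. u *\<^sub>R f n + v *\<^sub>R g n) \<longlonglongrightarrow> u *\<^sub>R x + v *\<^sub>R y"
    by (intro tendsto_intros)
  moreover have "u *\<^sub>R f n + v *\<^sub>R g n \<in> K n" for n
    using * by (intro convexD[OF assms]) auto
  ultimately show "\<exists>h. (\<forall>n. h n \<in> K n) \<and> h \<longlonglongrightarrow> u *\<^sub>R x + v *\<^sub>R y"
    by (intro exI[of _ "\<lambda>n. u *\<^sub>R f n + v *\<^sub>R g n"]) auto
qed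

section \<open>Extremal tournaments\<close>

text \<open>A series of at most \<open>m\<close> matches: \<open>S\<close> follows if
  \<open>i\<close> sweeps it, and \<open>S'\<close> follows at the first win of
  \<open>j\<close>.\<close>

primrec streak :: "nat \<Rightarrow> nat \<Rightarrow> rules \<Rightarrow> rules \<Rightarrow> nat \<Rightarrow> rules" where
  "streak i j S S' 0 = S"
| "streak i j S S' (Suc m) = Match i j (streak i j S S' m) S'"

lemma relabel_streak:
  "relabel \<sigma> (streak i j S S' m) = streak (\<sigma> i) (\<sigma> j) (relabel \<sigma> S) (relabel \<sigma> S') m"
  by (induction m) auto

lemma win_prob_streak:
  assumes "P i j \<in> {0..1}"
  shows "win_prob (streak i j S S' m) P k = P i j ^ m * win_prob S P k + (1 - P i j ^ m) * win_prob S' P k"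
proof (induction m)
  case (Suc m)
  show ?case
    by (simp add: win_prob_Match[of P, OF assms] Suc.IH) (simp add: algebra_simps)
qed simp

lemma is_tournament_streak:
  assumes "is_tournament n S" "is_tournament n S'" "i \<in> {1..n}" "j \<in> {1..n}" "i \<noteq> j"
  shows "is_tournament n (streak i j S S' m)"
  using assms by (induction m) (auto simp: is_tournament_Match_iff)

lemma win_prob_streak_ge:
  assumes "P i j \<in> {0..1}" "win_prob S' P k \<le> win_prob S P k"
  shows "win_prob S' P k \<le> win_prob (streak i j S S' m) P k"
proof -
  have "0 \<le> P i j ^ m * (win_prob S P k - win_prob S' P k)"
    using assms by (auto intro!: mult_nonneg_nonneg)
  then show ?thesis
    by (simp add: win_prob_streak[of P, OF assms(1)] algebra_simps)
qed

lemma win_prob_streak_le: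
  assumes "P i j \<in> {0..1}" "win_prob S P k \<le> win_prob S' P k"
  shows "win_prob (streak i j S S' m) P k \<le> win_prob S' P k"
proof -
  have "0 \<le> P i j ^ m * (win_prob S' P k - win_prob S P k)"
    using assms by (auto intro!: mult_nonneg_nonneg)
  then show ?thesis
    by (simp add: win_prob_streak[of P, OF assms(1)] algebra_simps)
qed

text \<open>An unfinished series is a convex combination of \<open>S\<close> and \<open>S'\<close>,
  so compared with \<open>S'\<close> it inherits the preferences that both opponents have between
  \<open>S\<close> and \<open>S'\<close>.\<close>

lemma honest_tournament_streak:
  assumes "honest_tournament n S" "honest_tournament n S'" "i \<in> {1..n}" "j \<in> {1..n}"
    and "\<And>P. P \<in> comparison_matrices n \<Longrightarrow>
      win_prob S' P i \<le> win_prob S P i \<and> win_prob S P j \<le> win_prob S' P j"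
  shows "honest_tournament n (streak i j S S' m)"
proof (induction m)
  case (Suc m)
  have "win_prob S' P i \<le> win_prob (streak i j S S' m) P i \<and>
      win_prob (streak i j S S' m) P j \<le> win_prob S' P j" if P: "P \<in> comparison_matrices n" for P
    using comparison_matrix_range(1)[OF P assms(3,4)] assms(5)[OF P]
    by (blast intro: win_prob_streak_ge win_prob_streak_le)
  then show ?case
    using Suc.IH assms(2) by (simp add: honest_tournament_Match_iff)
qed (simp add: assms)

section \<open>Small decision trees for the vertices\<close>

definition knockout :: "nat \<Rightarrow> nat \<Rightarrow> nat \<Rightarrow> rules" where
  "knockout i j k = Match i j (Match i k (Winner i) (Winner k)) (Match j k (Winner j) (Winner k))"

definition second_chance :: "nat \<Rightarrow> nat \<Rightarrow> nat \<Rightarrow> rules" where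
  "second_chance i j k = Match i j (Winner i) (Match i k (Winner i) (Winner k))"

definition eliminate_dominated :: "nat \<Rightarrow> nat \<Rightarrow> nat \<Rightarrow> nat \<Rightarrow> rules" where
  "eliminate_dominated m i j k = streak j i (Winner k) (Winner i) m"

definition select_dominant :: "nat \<Rightarrow> nat \<Rightarrow> nat \<Rightarrow> nat \<Rightarrow> rules" where
  "select_dominant m i j k =
     Match i j (streak i j (Winner i) (Winner k) m) (streak j i (Winner j) (Winner k) m)"

lemmas extremal_defs = knockout_def second_chance_def eliminate_dominated_def select_dominant_def

lemma extremal_is_tournament:
  assumes "{i, j, k} \<subseteq> {1..n}" "i \<noteq> j" "i \<noteq> k" "j \<noteq> k"
  shows "is_tournament n (knockout i j k)" "is_tournament n (second_chance i j k)"
    "is_tournament n (eliminate_dominated m i j k)" "is_tournament n (select_dominant m i j k)"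
  using assms unfolding extremal_defs
  by (auto simp: is_tournament_Match_iff is_tournament_Winner_iff intro!: is_tournament_streak)

text \<open>Honesty constrains only the two opponents, so the third player may profit from either
  result. In \<open>second_chance\<close> and \<open>eliminate_dominated\<close> player
  \<open>j\<close> never wins the tournament, and the condition for \<open>j\<close> reads
  \<open>0 \<le> 0\<close>.\<close>

lemma extremal_honest:
  assumes "{i, j, k} \<subseteq> {1..n}" "i \<noteq> j" "i \<noteq> k" "j \<noteq> k"
  shows "honest_tournament n (knockout i j k)" "honest_tournament n (second_chance i j k)"
    "honest_tournament n (eliminate_dominated m i j k)" "honest_tournament n (select_dominant m i j k)"
proof -
  have ijk: "i \<in> {1..n}" "j \<in> {1..n}" "k \<in> {1..n}"
    using assms by auto
  have bounds: "P a b \<le> 1" "0 \<le> P a b"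
    if "P \<in> comparison_matrices n" "a \<in> {i, j, k}" "b \<in> {i, j, k}" for P a b
    using comparison_matrix_range[OF that(1), of a b] ijk that(2,3) by auto
  have streak: "honest_tournament n (streak a b (Winner a) (Winner c) m)"
    "honest_tournament n (streak a b (Winner c) (Winner b) m)"
    if "a \<in> {1..n}" "b \<in> {1..n}" "a \<noteq> b" "c \<noteq> a" "c \<noteq> b" for a b c
    using that
    by (auto intro!: honest_tournament_streak simp: honest_tournament_Winner win_prob_Winner)
  show "honest_tournament n (knockout i j k)" "honest_tournament n (second_chance i j k)"
    "honest_tournament n (eliminate_dominated m i j k)" "honest_tournament n (select_dominant m i j k)"
    using assms(2-) streak ijk unfolding extremal_defs
    by (auto simp: honest_tournament_Match_iff honest_tournament_Winner win_prob_Match win_prob_Winner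
        win_prob_streak bounds power_le_one)
qed

text \<open>Six times the win probability in the symmetrization, for a family \<open>T\<close> on
  which relabelling just permutes the arguments.\<close>

definition orbit_sum ::
  "(nat \<Rightarrow> nat \<Rightarrow> nat \<Rightarrow> rules) \<Rightarrow> (nat \<Rightarrow> nat \<Rightarrow> real) \<Rightarrow> nat \<Rightarrow> real" where
  "orbit_sum T P l =
     win_prob (T 1 2 3) P l + win_prob (T 1 3 2) P l + win_prob (T 2 1 3) P l +
     win_prob (T 2 3 1) P l + win_prob (T 3 1 2) P l + win_prob (T 3 2 1) P l"

section \<open>Limits along one sequence of matrices\<close>

context
  fixes q :: "nat \<Rightarrow> real" and N :: "nat \<Rightarrow> nat"
  assumes q: "\<And>n. 1/2 \<le> q n" "\<And>n. q n \<le> 1" "q \<longlonglongrightarrow> 1"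
    and N: "\<And>n. 0 < N n" "(\<lambda>n. q n ^ N n) \<longlonglongrightarrow> 0"
begin

text \<open>The tournament may vary with \<open>n\<close>, but the matrices are common to all
  sequences; this is what makes the set of limits convex.\<close>

definition attainable_limits :: "(real ^ 3) set" where
  "attainable_limits = {x. \<exists>f.
     (\<forall>n. f n \<in> (\<lambda>T. win_vector3 T (matrix3 (q n) 1 (q n))) ` fair_tournaments 3) \<and> f \<longlonglongrightarrow> x}"

lemma attainable_limits_symmetrize:
  fixes T :: "nat \<Rightarrow> nat \<Rightarrow> nat \<Rightarrow> nat \<Rightarrow> rules"
  defines "u \<equiv> \<lambda>n. orbit_sum (T n) (matrix3 (q n) 1 (q n))"
  assumes relabel: "\<And>n \<sigma> i j k. relabel \<sigma> (T n i j k) = T n (\<sigma> i) (\<sigma> j) (\<sigma> k)"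
    and T: "\<And>n. is_tournament 3 (T n 1 2 3)" "\<And>n. honest_tournament 3 (T n 1 2 3)"
    and lim: "(\<lambda>n. u n 1) \<longlonglongrightarrow> 6 * x" "(\<lambda>n. u n 2) \<longlonglongrightarrow> 6 * y" "(\<lambda>n. u n 3) \<longlonglongrightarrow> 6 * z"
  shows "vector [x, y, z] \<in> attainable_limits"
proof -
  let ?P = "\<lambda>n. matrix3 (q n) 1 (q n)"
  let ?f = "\<lambda>n. win_vector3 (symmetrize 3 (T n 1 2 3)) (?P n)"
  have "(\<lambda>n. win_prob (symmetrize 3 (T n 1 2 3)) (?P n) l) \<longlonglongrightarrow> v" if "(\<lambda>n. u n l) \<longlonglongrightarrow> 6 * v" for l v
  proof -
    have eq: "win_prob (symmetrize 3 (T n 1 2 3)) (?P n) l = u n l / fact 3" for n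
      unfolding win_prob_symmetrize relabel u_def orbit_sum_def
      using sum_permutations_3[of "\<lambda>i j k. win_prob (T n i j k) (?P n) l"] by simp
    show ?thesis
      unfolding eq using tendsto_divide[OF that tendsto_const[of "fact 3"]]
      by (simp add: fact_numeral)
  qed
  then have "\<forall>i. (\<lambda>n. ?f n $ i) \<longlonglongrightarrow> vector [x, y, z] $ i"
    using lim by (simp add: forall_3 vector_3)
  then have "?f \<longlonglongrightarrow> vector [x, y, z]"
    by (intro vec_tendstoI) blast
  moreover have "?f n \<in> (\<lambda>T. win_vector3 T (?P n)) ` fair_tournaments 3" for n
    using symmetrize_fair[OF T] by blast
  ultimately show ?thesis
    unfolding attainable_limits_def by (intro CollectI exI[of _ ?f] conjI allI)
qed

text \<open>Since \<open>q n \<ge> 1/2\<close>, sweeping a series is at most as likely for the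
  weaker of two neighbouring players as for the stronger one.\<close>

lemma complement_power_tendsto_0: "(\<lambda>n. (1 - q n) ^ N n) \<longlonglongrightarrow> 0"
proof (rule tendsto_sandwich[OF _ _ tendsto_const N(2)])
  show "\<forall>\<^sub>F n in sequentially. 0 \<le> (1 - q n) ^ N n"
    using q by (intro always_eventually) simp
  have "1 - q n \<le> q n" "0 \<le> 1 - q n" for n
    using q(1,2)[of n] by simp_all
  then show "\<forall>\<^sub>F n in sequentially. (1 - q n) ^ N n \<le> q n ^ N n"
    by (intro always_eventually allI power_mono)
qed

text \<open>A positive length makes \<open>0 ^ N n\<close> vanish: player 3 never sweeps player
  1.\<close>

lemma q_nonneg: "0 \<le> q n" and N_nonzero: "N n \<noteq> 0"
  using q(1)[of n] N(1)[of n] by simp_all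

lemma attainable_vertices:
  "vector [1, 0, 0] \<in> attainable_limits"
  "vector [1/2, 1/2, 0] \<in> attainable_limits"
  "vector [1/3, 1/2, 1/6] \<in> attainable_limits"
  "vector [1/3, 1/3, 1/3] \<in> attainable_limits"
  "vector [2/3, 0, 1/3] \<in> attainable_limits"
proof -
  note simps = orbit_sum_def extremal_defs win_prob_Match win_prob_Winner win_prob_streak
    q_nonneg q(2) N_nonzero power_0_left relabel_streak is_tournament_Winner_iff honest_tournament_Winner
  note tendsto = q(3) N(2) complement_power_tendsto_0
  \<comment> \<open>In the limit the smaller number wins each single match, so player 1 wins for all
    six seedings.\<close>
  show "vector [1, 0, 0] \<in> attainable_limits"
    by (rule attainable_limits_symmetrize[where T = "\<lambda>n. knockout"];
        ((rule extremal_is_tournament extremal_honest; simp)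
        | (auto simp: simps intro!: tendsto_eq_intros tendsto)))
  \<comment> \<open>In the limit \<open>i = 1\<close> wins at once, \<open>i = 2\<close> beats
    player 3 in one of the two matches, and \<open>i = 3\<close> loses both and \<open>k\<close>
    wins: the counts are 3, 3, 0.\<close>
  show "vector [1/2, 1/2, 0] \<in> attainable_limits"
    by (rule attainable_limits_symmetrize[where T = "\<lambda>n. second_chance"];
        ((rule extremal_is_tournament extremal_honest; simp)
        | (auto simp: simps intro!: tendsto_eq_intros tendsto)))
  \<comment> \<open>In the limit \<open>i\<close> wins except when \<open>i = 3\<close>,
    \<open>j = 1\<close>; there the sweep hands the title to player 2: the counts are 2, 3,
    1.\<close>
  show "vector [1/3, 1/2, 1/6] \<in> attainable_limits"
    by (rule attainable_limits_symmetrize[where T = "\<lambda>n. eliminate_dominated (N n)"];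
        ((rule extremal_is_tournament extremal_honest; simp)
        | (auto simp: simps intro!: tendsto_eq_intros tendsto)))
  \<comment> \<open>A uniformly drawn winner.\<close>
  show "vector [1/3, 1/3, 1/3] \<in> attainable_limits"
    by (rule attainable_limits_symmetrize[where T = "\<lambda>n i j k. Winner i"];
        ((rule extremal_is_tournament extremal_honest; simp)
        | (auto simp: simps intro!: tendsto_eq_intros tendsto)))
  \<comment> \<open>In the limit the pair 1, 3 ends with a sweep by player 1, while the pairs 1, 2
    and 2, 3 leave the title to the outsider, 3 and 1 respectively: the counts are 4, 0, 2.\<close>
  show "vector [2/3, 0, 1/3] \<in> attainable_limits"
    by (rule attainable_limits_symmetrize[where T = "\<lambda>n. select_dominant (N n)"];
        ((rule extremal_is_tournament extremal_honest; simp)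
        | (auto simp: simps intro!: tendsto_eq_intros tendsto)))
qed

lemma convex_attainable_limits: "convex attainable_limits"
  unfolding attainable_limits_def by (intro convex_limits convex_win_vector3)

lemma attainable_limits_subset: "attainable_limits \<subseteq> achievable3"
proof
  fix x assume "x \<in> attainable_limits"
  then obtain f where f: "\<And>n. f n \<in> (\<lambda>T. win_vector3 T (matrix3 (q n) 1 (q n))) ` fair_tournaments 3"
    and lim: "f \<longlonglongrightarrow> x"
    unfolding attainable_limits_def by blast
  have "matrix3 (q n) 1 (q n) \<in> doubly_monotonic_matrices 3" for n
    using q by (intro matrix3_doubly_monotonic) auto
  then have "f n \<in> {win_vector3 T P | T P. is_tournament 3 T \<and> symmetric_tournament 3 T \<and>
      honest_tournament 3 T \<and> P \<in> doubly_monotonic_matrices 3}" for n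
    using f[of n] unfolding fair_tournaments_def by blast
  then show "x \<in> achievable3"
    unfolding achievable3_def using lim closure_sequential by blast
qed

end

section \<open>The achievable set\<close>

text \<open>The slice at height \<open>x $ 3 = 1/3 - w\<close> is a segment. Its end with least
  first coordinate \<open>l\<close> lies on \<open>x $ 1 = 1/3\<close> or on
  \<open>x $ 2 = 1/2\<close>, its other end on \<open>x $ 2 = 0\<close>. Both ends lie on edges
  between given vertices, and \<open>x\<close> lies between them.\<close>

lemma pentagon_subset_convex:
  fixes K :: "(real ^ 3) set"
  assumes K: "convex K" and vertices: "vector [1, 0, 0] \<in> K" "vector [1/2, 1/2, 0] \<in> K"
      "vector [1/3, 1/2, 1/6] \<in> K" "vector [1/3, 1/3, 1/3] \<in> K" "vector [2/3, 0, 1/3] \<in> K"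
    and x: "x \<in> prob_simplex3" "1/3 \<le> x $ 1" "x $ 2 \<le> 1/2" "x $ 3 \<le> 1/3"
  shows "x \<in> K"
proof -
  define w where "w = 1/3 - x $ 3"
  define l where "l = max (1/3) (w + 1/6)"
  have bounds: "0 \<le> w" "w \<le> 1/3" "l \<le> x $ 1" "x $ 1 \<le> 2/3 + w"
    and x2: "x $ 2 = 2/3 + w - x $ 1"
    using x by (auto simp: prob_simplex3_def w_def l_def)
  \<comment> \<open>The two edges meet at the vertex with \<open>w = 1/6\<close>, where the two
    terms of the maximum \<open>l\<close> coincide.\<close>
  have left: "vector [l, 2/3 + w - l, 1/3 - w] \<in> K"
  proof (cases "w \<le> 1/6")
    case True
    then have "vector [l, 2/3 + w - l, 1/3 - w] =
        (1 - 6 * w) *\<^sub>R vector [1/3, 1/3, 1/3] + (6 * w) *\<^sub>R (vector [1/3, 1/2, 1/6] :: real ^ 3)"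
      by (simp add: vec_eq_iff forall_3 vector_3 l_def field_simps)
    then show ?thesis
      using convexD_alt[OF K vertices(4,3), of "6 * w"] bounds True by simp
  next
    case False
    then have "vector [l, 2/3 + w - l, 1/3 - w] =
        (1 - (6 * w - 1)) *\<^sub>R vector [1/3, 1/2, 1/6] + (6 * w - 1) *\<^sub>R (vector [1/2, 1/2, 0] :: real ^ 3)"
      by (simp add: vec_eq_iff forall_3 vector_3 l_def field_simps)
    then show ?thesis
      using convexD_alt[OF K vertices(3,2), of "6 * w - 1"] bounds False by simp
  qed
  have "vector [2/3 + w, 0, 1/3 - w] =
      (1 - 3 * w) *\<^sub>R vector [2/3, 0, 1/3] + (3 * w) *\<^sub>R (vector [1, 0, 0] :: real ^ 3)"
    by (simp add: vec_eq_iff forall_3 vector_3 field_simps)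
  then have right: "vector [2/3 + w, 0, 1/3 - w] \<in> K"
    using convexD_alt[OF K vertices(5,1), of "3 * w"] bounds by simp
  \<comment> \<open>Relative position of \<open>x\<close> in its slice, whose length in the first
    coordinate is the denominator.\<close>
  define t where "t = (x $ 1 - l) / (2/3 + w - l)"
  have pos: "0 < 2/3 + w - l"
    using bounds by (auto simp: l_def)
  then have t: "0 \<le> t" "t \<le> 1" "t * (2/3 + w - l) = x $ 1 - l"
    using bounds by (auto simp: t_def field_simps)
  have "x = (1 - t) *\<^sub>R vector [l, 2/3 + w - l, 1/3 - w] + t *\<^sub>R vector [2/3 + w, 0, 1/3 - w]"
    using t(3) x2 by (simp add: vec_eq_iff forall_3 vector_3 w_def algebra_simps)
  then show ?thesis
    using convexD_alt[OF K left right t(1,2)] by simp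
qed

lemma win_vector3_bounds:
  assumes T: "is_tournament 3 T" "symmetric_tournament 3 T" "honest_tournament 3 T"
    and P: "P \<in> doubly_monotonic_matrices 3"
  shows "win_vector3 T P \<in> {x \<in> prob_simplex3. x $ 1 \<ge> 1/3 \<and> x $ 2 \<le> 1/2 \<and> x $ 3 \<le> 1/3}"
proof -
  obtain a b c where abc: "1/2 \<le> a" "a \<le> b" "1/2 \<le> c" "c \<le> b" "b \<le> 1"
    and "\<And>i j. i \<in> {1..3} \<Longrightarrow> j \<in> {1..3} \<Longrightarrow> P i j = matrix3 a b c i j"
    using P by (rule doubly_monotonic3E) blast
  then have "win_prob T P = win_prob T (matrix3 a b c)"
    using winner_pmf_cong[OF T(1)] unfolding win_prob_def by metis
  then show ?thesis
    using win_prob3_bounds[OF T(1,3,2) abc] win_prob3_sum[OF T(1,3,2), of "matrix3 a b c"]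
    by (simp add: prob_simplex3_def win_prob_nonneg)
qed

theorem theorem3p6:
  "achievable3 = {x \<in> prob_simplex3. x $ 1 \<ge> 1/3 \<and> x $ 2 \<le> 1/2 \<and> x $ 3 \<le> 1/3}"
  (is "_ = ?R")
proof
  have "closed ?R"
    unfolding prob_simplex3_def mem_Collect_eq
    by (intro closed_Collect_conj closed_Collect_le closed_Collect_eq continuous_intros)
  then show "achievable3 \<subseteq> ?R"
    unfolding achievable3_def using win_vector3_bounds by (intro closure_minimal) blast+
next
  \<comment> \<open>The shift by 2 gives \<open>q = 1/2\<close> at \<open>n = 0\<close>. The
    quadratic length makes \<open>q ^ N\<close> decay roughly like \<open>exp (- n)\<close>; a
    length of order \<open>n\<close> would leave a positive limit.\<close>
  let ?q = "\<lambda>n. 1 - 1 / (real n + 2)" and ?N = "\<lambda>n. (n + 2) ^ 2"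
  have q: "1/2 \<le> ?q n" "?q n \<le> 1" "0 < ?N n" for n
    by (auto simp: field_simps)
  have lim: "?q \<longlonglongrightarrow> 1" "(\<lambda>n. ?q n ^ ?N n) \<longlonglongrightarrow> 0"
    by real_asymp+
  note assms = q(1,2) lim(1) q(3) lim(2)
  show "?R \<subseteq> achievable3"
  proof
    fix x assume x: "x \<in> ?R"
    have "x \<in> attainable_limits ?q"
      by (rule pentagon_subset_convex[OF convex_attainable_limits[OF assms]])
         (use attainable_vertices[OF assms] x in simp_all)
    then show "x \<in> achievable3"
      using attainable_limits_subset[OF assms] by blast
  qed
qed

end
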